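(* For every integer $l\ge 0$, $$E_{2l}=1-\frac{1}{2l+1}\sum_{j=1}^{l}\binom{2l+1}{2j}2^{2j}(2^{2j}-1)B_{2j}.$$
   Context: The Bernoulli numbers $B_n$ and the Euler numbers $E_n$ are defined by $\frac{x}{e^x-1}=\sum_{n=0}^{+\infty}\frac{B_n}{n!}x^n$ and $\frac{2}{e^x+e^{-x}}=\sum_{n=0}^{+\infty}\frac{E_n}{n!}x^n$. An empty sum (such as $\sum_{j=1}^{0}$) equals $0$. *)

theory Defs
  imports Complex_Main "HOL-Computational_Algebra.Formal_Power_Series"
begin

text \<open>
  Both generating functions are read as identities of formal power series.  In the first one
  the divisor has zero constant term; fps division cancels the common factor X,
  so this is the usual quotient with B 0 = 1 and B 1 = - 1 / 2.
\<close>

definition bernoulli_number :: "nat \<Rightarrow> real" where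
  "bernoulli_number n = fact n * fps_nth (fps_X / (fps_exp 1 - 1)) n"

definition euler_number :: "nat \<Rightarrow> real" where
  "euler_number n = fact n * fps_nth (2 / (fps_exp 1 + fps_exp (- 1))) n"

lemma bernoulli_number_gf:
  "Abs_fps (\<lambda>n. bernoulli_number n / fact n) = fps_X / (fps_exp 1 - 1)"
  by (simp add: fps_eq_iff bernoulli_number_def)

lemma bernoulli_number_gf_mult:
  "Abs_fps (\<lambda>n. bernoulli_number n / fact n) * (fps_exp 1 - 1) = fps_X"
proof -
  have nz: "fps_nth (fps_exp (1::real) - 1) 1 \<noteq> 0" by simp
  have "subdegree (fps_exp (1::real) - 1) = 1"
    by (rule subdegreeI) auto
  moreover have "subdegree (fps_X :: real fps) = 1" by simp
  ultimately have "(fps_exp (1::real) - 1) dvd fps_X"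
    using nz by (subst fps_dvd_iff) auto
  then show ?thesis by (simp add: bernoulli_number_gf)
qed

lemma euler_number_gf:
  "Abs_fps (\<lambda>n. euler_number n / fact n) = 2 / (fps_exp 1 + fps_exp (- 1))"
  by (simp add: fps_eq_iff euler_number_def)

lemma euler_number_gf_mult:
  "Abs_fps (\<lambda>n. euler_number n / fact n) * (fps_exp 1 + fps_exp (- 1)) = 2"
proof -
  have "subdegree (fps_exp (1::real) + fps_exp (- 1)) = 0"
    by (rule subdegreeI) auto
  moreover have "fps_exp (1::real) + fps_exp (- 1) \<noteq> 0"
    by (auto simp: fps_eq_iff intro!: exI[of _ 0])
  ultimately have "(fps_exp (1::real) + fps_exp (- 1)) dvd 2"
    by (subst fps_dvd_iff) auto
  then show ?thesis by (simp add: euler_number_gf)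
qed

end

theory Submission
  imports Defs
begin

text \<open>
  With B and E the two generating functions, G(x) = B(4x) - B(2x) has coefficients
  2^n (2^n - 1) B_n / n!, and G(x) = -2x / (exp(2x) + 1).  Hence exp(x) G(x) = -x E(x), whose
  coefficient of index 2l + 1 is the recurrence summed over all indices; and
  G(x) - G(-x) = -2x, so among the odd indices only the first contributes.
\<close>

definition bernoulli_fps :: "real fps" where
  "bernoulli_fps = Abs_fps (\<lambda>n. bernoulli_number n / fact n)"

definition euler_fps :: "real fps" where
  "euler_fps = Abs_fps (\<lambda>n. euler_number n / fact n)"

definition scaled_bernoulli_fps :: "real fps" where
  "scaled_bernoulli_fps = Abs_fps (\<lambda>n. 2 ^ n * (2 ^ n - 1) * bernoulli_number n / fact n)"

text \<open>Composition respects products and differences, so substituting cx into the product form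
  of the generating function needs no division.\<close>

lemma bernoulli_fps_compose_linear:
  "(bernoulli_fps oo (fps_const c * fps_X)) * (fps_exp c - 1) = fps_const c * fps_X"
proof -
  have "(bernoulli_fps * (fps_exp 1 - 1)) oo (fps_const c * fps_X) = fps_X oo (fps_const c * fps_X)"
    by (simp only: bernoulli_fps_def bernoulli_number_gf_mult)
  then show ?thesis
    by (simp add: fps_compose_mult_distrib fps_compose_sub_distrib)
qed

lemma scaled_bernoulli_fps_eq:
  "scaled_bernoulli_fps =
    (bernoulli_fps oo (fps_const 4 * fps_X)) - (bernoulli_fps oo (fps_const 2 * fps_X))"
proof (rule fps_ext)
  fix n
  have "(4::real) ^ n = 2 ^ n * 2 ^ n"
    by (simp flip: power_mult_distrib)
  then show "fps_nth scaled_bernoulli_fps n =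
    fps_nth ((bernoulli_fps oo (fps_const 4 * fps_X)) - (bernoulli_fps oo (fps_const 2 * fps_X))) n"
    by (simp add: scaled_bernoulli_fps_def bernoulli_fps_def right_diff_distrib left_diff_distrib
        diff_divide_distrib)
qed

text \<open>The constant term is 2. This justifies the later cancellations of exp(x) + exp(-x) and
  of exp(2x) + 1.\<close>

lemma fps_exp_plus_nonzero: "fps_exp a + fps_exp b \<noteq> (0 :: real fps)"
proof
  assume "fps_exp a + fps_exp b = (0 :: real fps)"
  then have "fps_nth (fps_exp a + fps_exp b :: real fps) 0 = 0" by simp
  then show False by simp
qed

text \<open>Since exp(4x) - 1 = (exp(2x) - 1)(exp(2x) + 1), multiplying by exp(2x) - 1 clears both
  denominators and leaves 4x - 2x(exp(2x) + 1) = -2x(exp(2x) - 1).\<close>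

lemma scaled_bernoulli_fps_mult:
  "scaled_bernoulli_fps * (fps_exp 2 + 1) = - (2 * fps_X)"
proof -
  let ?e = "fps_exp 2 :: real fps"
  have e4: "fps_exp (4::real) = ?e * ?e"
    by (simp flip: fps_exp_add_mult)
  \<comment> \<open>The constant term vanishes, so index 1 is the first that separates this series
    from zero.\<close>
  have "fps_nth (?e - 1) 1 \<noteq> fps_nth 0 1" by simp
  then have nz: "?e - 1 \<noteq> 0" by metis
  have B4: "(bernoulli_fps oo (fps_const 4 * fps_X)) * (?e * ?e - 1) = 4 * fps_X"
    using bernoulli_fps_compose_linear[of 4] by (simp add: e4 numeral_fps_const)
  have B2: "(bernoulli_fps oo (fps_const 2 * fps_X)) * (?e - 1) = 2 * fps_X"
    using bernoulli_fps_compose_linear[of 2] by (simp add: numeral_fps_const)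
  have "(scaled_bernoulli_fps * (?e + 1)) * (?e - 1) =
      (bernoulli_fps oo (fps_const 4 * fps_X)) * (?e * ?e - 1)
      - ((bernoulli_fps oo (fps_const 2 * fps_X)) * (?e - 1)) * (?e + 1)"
    unfolding scaled_bernoulli_fps_eq by algebra
  also have "\<dots> = - (2 * fps_X) * (?e - 1)"
    unfolding B4 B2 by (simp add: algebra_simps)
  finally show ?thesis using mult_right_cancel[OF nz] by blast
qed

text \<open>After multiplication by exp(x) + exp(-x), both sides equal -2x: on the left exp(x) turns
  this factor into exp(2x) + 1, on the right it cancels the denominator of the Euler series.\<close>

lemma fps_exp_scaled_bernoulli_fps:
  "scaled_bernoulli_fps * fps_exp 1 = - (fps_X * euler_fps)"
proof -
  let ?c = "fps_exp 1 + fps_exp (- 1) :: real fps"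
  have e: "fps_exp 1 * ?c = fps_exp (2::real) + 1"
    by (simp add: distrib_left flip: fps_exp_add_mult)
  have E: "euler_fps * ?c = 2"
    unfolding euler_fps_def by (rule euler_number_gf_mult)
  have "(scaled_bernoulli_fps * fps_exp 1) * ?c = scaled_bernoulli_fps * (fps_exp 2 + 1)"
    by (simp only: mult.assoc e)
  also have "\<dots> = - (fps_X * (euler_fps * ?c))"
    unfolding scaled_bernoulli_fps_mult E by (simp add: mult.commute)
  also have "\<dots> = - (fps_X * euler_fps) * ?c"
    by (simp only: mult.assoc mult_minus_left)
  finally show ?thesis
    using mult_right_cancel[OF fps_exp_plus_nonzero] by blast
qed

lemma scaled_bernoulli_fps_odd_part:
  "scaled_bernoulli_fps - (scaled_bernoulli_fps oo (fps_const (- 1) * fps_X)) = - (2 * fps_X)"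
proof -
  let ?G = "scaled_bernoulli_fps" and ?G' = "scaled_bernoulli_fps oo (fps_const (- 1) * fps_X)"
  let ?e = "fps_exp 2 :: real fps"
  have "(?G * (?e + 1)) oo (fps_const (- 1) * fps_X) = - (2 * fps_X) oo (fps_const (- 1) * fps_X)"
    by (simp only: scaled_bernoulli_fps_mult)
  then have *: "?G' * (fps_exp (- 2) + 1) = 2 * fps_X"
    by (simp add: fps_compose_mult_distrib fps_compose_add_distrib fps_compose_uminus
        numeral_fps_const flip: fps_const_neg)
  \<comment> \<open>This puts G(-x) over the same denominator as G(x), with numerator 2x
    exp(2x).\<close>
  have e: "(fps_exp (- 2) + 1) * ?e = ?e + 1"
    by (simp add: distrib_right flip: fps_exp_add_mult)
  have "?G' * (?e + 1) = 2 * fps_X * ?e"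
    by (simp only: mult.assoc * flip: e) (simp only: * flip: mult.assoc)
  then have "(?G - ?G') * (?e + 1) = - (2 * fps_X) * (?e + 1)"
    unfolding left_diff_distrib scaled_bernoulli_fps_mult by (simp add: distrib_left)
  \<comment> \<open>The summand 1 is \<open>fps_exp 0\<close>.\<close>
  moreover have "?e + 1 \<noteq> 0"
    using fps_exp_plus_nonzero[of 2 0] by simp
  ultimately show ?thesis using mult_right_cancel by blast
qed

text \<open>At an odd index the coefficient of G(x) - G(-x) is twice that of G.\<close>

lemma scaled_bernoulli_odd:
  assumes "odd n"
  shows "2 ^ n * (2 ^ n - 1) * bernoulli_number n = (if n = 1 then - 1 else 0)"
proof -
  have "fps_nth (scaled_bernoulli_fps - (scaled_bernoulli_fps oo (fps_const (- 1) * fps_X))) n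
      = fps_nth (- (2 * fps_X)) n"
    by (simp only: scaled_bernoulli_fps_odd_part)
  then have "2 * fps_nth scaled_bernoulli_fps n = (if n = 1 then - 2 else 0)"
    using assms by (simp add: fps_nth_compose_linear numeral_fps_const)
  then show ?thesis
    by (auto simp: scaled_bernoulli_fps_def split: if_splits)
qed

text \<open>Compare coefficients of index m + 1 in exp(x) G(x) = -x E(x): the factor x lowers the
  Euler index to m, and (m + 1)! / m! gives the factor \<open>Suc m\<close>.\<close>

lemma sum_scaled_bernoulli:
  "(\<Sum>k = 0..Suc m. real (Suc m choose k) * (2 ^ k * (2 ^ k - 1) * bernoulli_number k)) =
    - (real (Suc m) * euler_number m)"
proof -
  let ?a = "\<lambda>k. 2 ^ k * (2 ^ k - 1) * bernoulli_number k"
  have "(\<Sum>k = 0..Suc m. real (Suc m choose k) * ?a k) =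
      fact (Suc m) * (\<Sum>k = 0..Suc m. ?a k / fact k * (1 / fact (Suc m - k)))"
    unfolding sum_distrib_left
    by (intro sum.cong) (simp_all add: binomial_fact)
  also have "(\<Sum>k = 0..Suc m. ?a k / fact k * (1 / fact (Suc m - k))) =
      fps_nth (scaled_bernoulli_fps * fps_exp 1) (Suc m)"
    by (simp add: fps_mult_nth scaled_bernoulli_fps_def)
  also have "\<dots> = - (euler_number m / fact m)"
    by (simp add: fps_exp_scaled_bernoulli_fps euler_fps_def)
  finally show ?thesis by simp
qed

theorem mainTheorem2:
  fixes l :: nat
  shows "euler_number (2 * l) =
    1 - 1 / (2 * real l + 1) *
      (\<Sum>j = 1..l. real ((2 * l + 1) choose (2 * j)) * 2 ^ (2 * j) * (2 ^ (2 * j) - 1) * bernoulli_number (2 * j))"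
proof -
  let ?n = "Suc (2 * l)"
  let ?f = "\<lambda>k. real (?n choose k) * (2 ^ k * (2 ^ k - 1) * bernoulli_number k)"
  let ?S = "\<Sum>j = 1..l. real ((2 * l + 1) choose (2 * j)) * 2 ^ (2 * j) * (2 ^ (2 * j) - 1) * bernoulli_number (2 * j)"
  have odd: "?f (Suc (2 * j)) = (if j = 0 then - real ?n else 0)" for j
    by (subst scaled_bernoulli_odd) auto
  \<comment> \<open>The upper index 2l + 1 is odd, so the range splits exactly into pairs 2j, 2j +
    1.\<close>
  have "(\<Sum>k = 0..?n. ?f k) = (\<Sum>j = 0..l. ?f (2 * j)) + (\<Sum>j = 0..l. ?f (Suc (2 * j)))"
    using sum.in_pairs[of ?f 0 l] by (simp add: sum.distrib)
  also have "(\<Sum>j = 0..l. ?f (Suc (2 * j))) = - real ?n"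
    unfolding odd by simp
  \<comment> \<open>The term at j = 0 vanishes because 2^0 - 1 = 0.\<close>
  also have "(\<Sum>j = 0..l. ?f (2 * j)) = ?S"
    by (simp add: sum.atLeast_Suc_atMost mult.assoc)
  finally have "?S = real ?n - real ?n * euler_number (2 * l)"
    using sum_scaled_bernoulli[of "2 * l"] by simp
  then show ?thesis by (simp add: field_simps)
qed

end
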